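(* Let $p$ be a prime, let $\alpha_p\geq 1$ be an integer, and let $q$ be a prime with $q\neq p$. Let $k$ be an integer with $1\leq k\leq \alpha_p$ and assume that $$q\geq p^{\alpha_p}\big((p-1)(2\alpha_p-k)+2\big)-2.$$ Let $n$ be a positive integer, and suppose that there are (not necessarily distinct) positive integers $x_1,\dots,x_n$ with $\sum_{i=1}^n \frac{1}{x_i}=1$, each $x_i$ being of the form $p^{a}q^{b}$ with integers $0\leq a\leq \alpha_p$ and $b\geq 0$ (the exponents depending on $i$), and such that $p$ divides at least one of the $x_i$ and $q$ divides at least one of the $x_i$. Then $$n\geq \min_{1\leq s\leq p^k-1}\left[\frac{sq-\{ sq\}_{\alpha_p}}{p^{\alpha_p}}+N\big(\{ sq\}_{\alpha_p}\big)\right]+(\alpha_p-k)(p-1)+1,$$ where the minimum is over integers $s$.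
   Context: For an integer $m$, $\{m\}_{\alpha_p}$ denotes the residue of $m$ modulo $p^{\alpha_p}$, i.e. the unique integer $r$ with $0\leq r<p^{\alpha_p}$ and $r\equiv m \pmod{p^{\alpha_p}}$. For a nonnegative integer $\ell$ written in base $p$ as $\ell=\sum_{i}a_ip^i$ with $a_i\in\{0,1,\dots,p-1\}$, $N(\ell)=\sum_i a_i$ denotes the sum of its base-$p$ digits. *)

theory Defs
  imports Complex_Main "HOL-Computational_Algebra.Primes"
begin

definition pow_residue :: "nat \<Rightarrow> nat \<Rightarrow> nat \<Rightarrow> nat" where
  "pow_residue p \<alpha> m = m mod p ^ \<alpha>"

text \<open>
  The \<open>i\<close>-th base-\<open>p\<close> digit of \<open>l\<close> is \<open>l div p ^ i mod p\<close>. Summing over \<open>i \<le> l\<close> loses nothing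
  for \<open>p \<ge> 2\<close>, because \<open>l < p ^ i\<close> for all \<open>i > l\<close>; see \<open>digit_sum_eq\<close>.
\<close>
definition digit_sum :: "nat \<Rightarrow> nat \<Rightarrow> nat" where
  "digit_sum p l = (\<Sum>i\<le>l. l div p ^ i mod p)"

lemma digit_of_expansion:
  fixes p :: nat
  assumes "\<And>i. i < m \<Longrightarrow> a i < p"
  shows "(\<Sum>i<m. a i * p ^ i) div p ^ j mod p = (if j < m then a j else 0)"
  using assms
proof (induction j arbitrary: m a)
  case 0
  show ?case
  proof (cases m)
    case (Suc m')
    have "(\<Sum>i<m. a i * p ^ i) = a 0 + p * (\<Sum>i<m'. a (Suc i) * p ^ i)"
      unfolding Suc sum.lessThan_Suc_shift by (simp add: sum_distrib_left mult_ac)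
    then show ?thesis using 0 Suc by simp
  qed simp
next
  case (Suc j)
  show ?case
  proof (cases m)
    case (Suc m')
    have "(\<Sum>i<m. a i * p ^ i) = a 0 + p * (\<Sum>i<m'. a (Suc i) * p ^ i)"
      unfolding Suc sum.lessThan_Suc_shift by (simp add: sum_distrib_left mult_ac)
    moreover have "a 0 < p" using Suc.prems[of 0] Suc by simp
    ultimately have "(\<Sum>i<m. a i * p ^ i) div p = (\<Sum>i<m'. a (Suc i) * p ^ i)"
      by simp
    then have "(\<Sum>i<m. a i * p ^ i) div p ^ Suc j = (\<Sum>i<m'. a (Suc i) * p ^ i) div p ^ j"
      by (simp add: div_mult2_eq)
    then show ?thesis
      using Suc.IH[of m' "\<lambda>i. a (Suc i)"] Suc.prems Suc by simp
  qed simp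
qed

lemma digit_sum_eq:
  fixes p :: nat
  assumes "p \<ge> 2" and l: "l = (\<Sum>i<m. a i * p ^ i)" and a: "\<And>i. i < m \<Longrightarrow> a i < p"
  shows "digit_sum p l = (\<Sum>i<m. a i)"
proof -
  have digit: "l div p ^ i mod p = (if i < m then a i else 0)" for i
    unfolding l by (rule digit_of_expansion) (rule a)
  have zero: "l div p ^ i = 0" if "l < i" for i
  proof -
    have "i < p ^ i" using assms(1) by (intro power_gt_expt) auto
    with that show ?thesis by simp
  qed
  have "digit_sum p l = (\<Sum>i<max m (Suc l). l div p ^ i mod p)"
    unfolding digit_sum_def by (rule sum.mono_neutral_left) (auto simp: zero)
  also have "\<dots> = (\<Sum>i<m. l div p ^ i mod p)"
    by (rule sum.mono_neutral_right) (auto simp: digit)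
  also have "\<dots> = (\<Sum>i<m. a i)"
    by (simp add: digit)
  finally show ?thesis .
qed

end

theory Submission
  imports Defs
begin

text \<open>
  Multiply \<open>\<Sum> 1 / x\<^sub>i = 1\<close> by \<open>P = p\<^sup>\<alpha>\<close>: then \<open>P\<close> is a sum of terms \<open>p\<^sup>e / q\<^sup>b\<close> with \<open>e \<le> \<alpha>\<close>.
  Collect the numerators belonging to the same \<open>b\<close> into one natural number \<open>M\<^sub>b\<close>. The number of
  terms used for \<open>M\<^sub>b\<close> is at least \<open>c(M\<^sub>b)\<close>, where \<open>c(m) = m div P + N(m mod P)\<close> is the least number
  of powers \<open>p\<^sup>0, \<dots>, p\<^sup>\<alpha>\<close> (with repetition) that add up to \<open>m\<close>; so \<open>n \<ge> \<Sum>\<^sub>b c(M\<^sub>b)\<close>. That \<open>c(m)\<close> bounds the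
  number of powers from below follows from its subadditivity and \<open>c(p\<^sup>e) = 1\<close> for \<open>e \<le> \<alpha>\<close>.

  Let \<open>s = \<Sum>\<^bsub>b \<ge> 1\<^esub> M\<^sub>b / q\<^sup>b = P - M\<^sub>0\<close>, an integer with \<open>1 \<le> s \<le> P\<close>. The terms with \<open>b \<ge> 1\<close> could be
  replaced by a single layer \<open>b = 1\<close> at no greater cost: clearing denominators from the largest \<open>b\<close>
  downwards, every layer passes an integer carry \<open>t\<close> to the next one and itself holds
  \<open>t * q\<close> minus the carry that it received. Since \<open>c(t) \<le> c(t * q)\<close> for \<open>q \<ge> P\<close>, subadditivity gives
  \<open>\<Sum>\<^bsub>b \<ge> 1\<^esub> c(M\<^sub>b) \<ge> c(s * q)\<close> (lemma \<open>power_cost_layers\<close>). Hence \<open>n \<ge> c(P - s) + c(s * q)\<close>.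

  If \<open>s < p\<^sup>k\<close>, then \<open>s\<close> competes in the minimum, and \<open>P - s\<close> has the digit \<open>p - 1\<close> at the
  \<open>\<alpha> - k\<close> places \<open>k, \<dots>, \<alpha> - 1\<close> and some nonzero digit below, so \<open>c(P - s) \<ge> (\<alpha> - k) (p - 1) + 1\<close>.
  If \<open>s \<ge> p\<^sup>k\<close>, then \<open>s \<ge> 2\<close> and already \<open>c(s * q) \<ge> 2 (q div P)\<close> is large enough: the hypothesis on \<open>q\<close>
  says just that one of the two summands \<open>q div P\<close> pays for \<open>(2 \<alpha> - k) (p - 1) + 1\<close>, while
  \<open>c(q) \<le> q div P + \<alpha> (p - 1)\<close>, so the value of the minimum at \<open>s = 1\<close> is small enough.
\<close>

section \<open>Sums of bounded powers of \<open>p\<close>\<close>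

text \<open>
  The least number of summands needed to write \<open>m\<close> as a sum of powers \<open>p\<^sup>0, \<dots>, p\<^sup>\<alpha>\<close>. Peeling off one digit
  at a time makes subadditivity an induction; lemma \<open>power_cost_eq_digit_sum\<close>
  recovers the closed form.
\<close>
fun power_cost :: "nat \<Rightarrow> nat \<Rightarrow> nat \<Rightarrow> nat" where
  "power_cost p 0 m = m"
| "power_cost p (Suc \<alpha>) m = m mod p + power_cost p \<alpha> (m div p)"

lemma power_cost_0 [simp]: "power_cost p \<alpha> 0 = 0"
  by (induction \<alpha>) auto

lemma power_cost_le:
  assumes "p \<ge> 2"
  shows "power_cost p \<alpha> m \<le> m"
proof (induction \<alpha> arbitrary: m)
  case (Suc \<alpha>)
  have "power_cost p (Suc \<alpha>) m \<le> m mod p + 1 * (m div p)"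
    using Suc by simp
  also have "\<dots> \<le> m mod p + p * (m div p)"
    using assms by (intro add_left_mono mult_right_mono) auto
  finally show ?case by simp
qed simp

lemma power_cost_power:
  assumes "p \<ge> 2" "e \<le> \<alpha>"
  shows "power_cost p \<alpha> (p ^ e) = 1"
  using assms(2)
proof (induction \<alpha> arbitrary: e)
  case (Suc \<alpha>)
  show ?case
  proof (cases e)
    case 0
    then show ?thesis using assms(1) by simp
  next
    case (Suc e')
    then show ?thesis using assms(1) Suc.IH[of e'] Suc.prems by simp
  qed
qed simp

text \<open>
  A carry in the lowest digit lowers the digit sum by \<open>p\<close> and costs at most one extra unit in
  the next digit.
\<close>
lemma power_cost_add:
  assumes "p \<ge> 2"
  shows "power_cost p \<alpha> (a + b) \<le> power_cost p \<alpha> a + power_cost p \<alpha> b"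
proof (induction \<alpha> arbitrary: a b)
  case (Suc \<alpha>)
  define r where "r = a mod p + b mod p"
  have r: "(a + b) mod p = r mod p" "(a + b) div p = a div p + b div p + r div p"
    unfolding r_def by (simp only: mod_add_eq, rule div_add1_eq)
  have "power_cost p \<alpha> (a div p + b div p + r div p)
      \<le> power_cost p \<alpha> (a div p) + power_cost p \<alpha> (b div p) + power_cost p \<alpha> (r div p)"
    using Suc[of "a div p + b div p" "r div p"] Suc[of "a div p" "b div p"] by linarith
  moreover have "power_cost p \<alpha> (r div p) \<le> r div p"
    by (rule power_cost_le[OF assms])
  moreover have "r mod p + r div p \<le> r"
    using power_cost_le[OF assms, of 1 r] by simp
  ultimately show ?case
    unfolding power_cost.simps r by (simp add: r_def)
qed simp

lemma power_cost_sum: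
  assumes "p \<ge> 2"
  shows "power_cost p \<alpha> (\<Sum>i\<in>I. f i) \<le> (\<Sum>i\<in>I. power_cost p \<alpha> (f i))"
proof (induction I rule: infinite_finite_induct)
  case (insert i I)
  then show ?case
    using power_cost_add[OF assms, of \<alpha> "f i" "sum f I"] by simp
qed auto

lemma power_cost_sum_powers_le_card:
  assumes "p \<ge> 2" "\<And>i. i \<in> I \<Longrightarrow> e i \<le> \<alpha>"
  shows "power_cost p \<alpha> (\<Sum>i\<in>I. p ^ e i) \<le> card I"
  using power_cost_sum[OF assms(1), of \<alpha> "\<lambda>i. p ^ e i" I] assms
  by (simp add: power_cost_power)

lemma power_cost_split_digits:
  "power_cost p (k + j) m = (\<Sum>i<k. m div p ^ i mod p) + power_cost p j (m div p ^ k)"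
  by (induction k arbitrary: m) (simp_all add: sum.lessThan_Suc_shift div_mult2_eq del: sum.lessThan_Suc)

lemma mod_power_eq_sum_digits:
  fixes m p :: nat
  shows "m mod p ^ k = (\<Sum>i<k. (m div p ^ i mod p) * p ^ i)"
proof (induction k)
  case (Suc k)
  then show ?case
    unfolding power_Suc2 mod_mult2_eq by (simp add: mult.commute)
qed simp

lemma power_cost_eq_digit_sum:
  assumes "p \<ge> 2"
  shows "power_cost p \<alpha> m = m div p ^ \<alpha> + digit_sum p (m mod p ^ \<alpha>)"
proof -
  have "digit_sum p (m mod p ^ \<alpha>) = (\<Sum>i<\<alpha>. m div p ^ i mod p)"
    using assms by (intro digit_sum_eq mod_power_eq_sum_digits) auto
  then show ?thesis
    using power_cost_split_digits[of p \<alpha> 0 m] by simp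
qed

lemma power_cost_ge_div:
  assumes "p \<ge> 2"
  shows "m div p ^ \<alpha> \<le> power_cost p \<alpha> m"
  by (simp add: power_cost_eq_digit_sum[OF assms])

lemma power_cost_upper:
  assumes "p \<ge> 2"
  shows "power_cost p \<alpha> m \<le> m div p ^ \<alpha> + \<alpha> * (p - 1)"
proof -
  have "m div p ^ i mod p \<le> p - 1" for i
    using mod_less_divisor[of p "m div p ^ i"] assms by linarith
  then have "(\<Sum>i<\<alpha>. m div p ^ i mod p) \<le> \<alpha> * (p - 1)"
    using sum_bounded_above[of "{..<\<alpha>}" "\<lambda>i. m div p ^ i mod p" "p - 1"] by simp
  then show ?thesis
    using power_cost_split_digits[of p \<alpha> 0 m] by simp
qed

lemma power_cost_power_minus_1:
  assumes "p \<ge> 2"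
  shows "power_cost p j (p ^ j - 1) = j * (p - 1)"
proof (induction j)
  case (Suc j)
  have "p ^ Suc j - 1 = (p - 1) + p * (p ^ j - 1)"
    using assms by (simp add: algebra_simps diff_mult_distrib2)
  moreover have "p - 1 < p" using assms by simp
  ultimately have "(p ^ Suc j - 1) mod p = p - 1" "(p ^ Suc j - 1) div p = p ^ j - 1"
    by (simp_all only: mod_mult_self2 mod_less div_mult_self2 div_less add_0_right)
  then show ?case using Suc by simp
qed simp

text \<open>
  Write \<open>p\<^sup>\<alpha> - s = p\<^sup>k (p\<^bsup>\<alpha>-k\<^esup> - 1) + (p\<^sup>k - s)\<close>: the upper \<open>\<alpha> - k\<close> digits all equal \<open>p - 1\<close>, and the
  lower part is a positive number.
\<close>
lemma power_cost_power_minus_small: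
  assumes "p \<ge> 2" "k \<le> \<alpha>" "1 \<le> s" "s < p ^ k"
  shows "power_cost p \<alpha> (p ^ \<alpha> - s) \<ge> (\<alpha> - k) * (p - 1) + 1"
proof -
  define m where "m = p ^ \<alpha> - s"
  have split: "p ^ \<alpha> = p ^ k * p ^ (\<alpha> - k)"
    using assms(2) by (simp flip: power_add)
  have le: "p ^ k * 1 \<le> p ^ k * p ^ (\<alpha> - k)"
    using assms(1) by (intro mult_left_mono) auto
  have m_eq: "m = (p ^ k - s) + p ^ k * (p ^ (\<alpha> - k) - 1)"
    unfolding m_def split diff_mult_distrib2 using le assms(4) by linarith
  have "p ^ k - s < p ^ k" using assms by simp
  then have m: "m div p ^ k = p ^ (\<alpha> - k) - 1" "m mod p ^ k = p ^ k - s"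
    unfolding m_eq by (simp_all only: mod_mult_self2 mod_less div_mult_self2 div_less add_0_right)
  have "m mod p ^ k \<noteq> 0" using m assms(4) by simp
  then have "(\<Sum>i<k. m div p ^ i mod p) \<noteq> 0"
    unfolding mod_power_eq_sum_digits by auto
  moreover have "power_cost p \<alpha> m = (\<Sum>i<k. m div p ^ i mod p) + (\<alpha> - k) * (p - 1)"
    using power_cost_split_digits[of p k "\<alpha> - k" m] m(1) assms(2)
      power_cost_power_minus_1[OF assms(1), of "\<alpha> - k"]
    by simp
  ultimately show ?thesis
    unfolding m_def[symmetric] by linarith
qed

section \<open>Collapsing the powers of \<open>q\<close>\<close>

text \<open>
  The equation says \<open>t = M 0 / q + \<dots> + M (B - 1) / q\<^sup>B\<close>. In the induction step, everything
  beyond the first layer contributes an integer carry \<open>t' = t * q - M 0\<close> to it, and replacing \<open>t' * q\<close>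
  by the cheaper \<open>t'\<close> merges the deeper layers into the first one.
\<close>
lemma power_cost_layers:
  assumes "p \<ge> 2" "q \<ge> p ^ \<alpha>" "q > 0"
    and "(\<Sum>b<B. M b * q ^ (B - 1 - b)) = t * q ^ B"
  shows "power_cost p \<alpha> (t * q) \<le> (\<Sum>b<B. power_cost p \<alpha> (M b))"
  using assms(4)
proof (induction B arbitrary: M t)
  case (Suc B)
  have mono: "power_cost p \<alpha> u \<le> power_cost p \<alpha> (u * q)" for u
  proof -
    have "u * p ^ \<alpha> div p ^ \<alpha> \<le> u * q div p ^ \<alpha>"
      using assms(2) by (intro div_le_mono) simp
    then have "u \<le> u * q div p ^ \<alpha>"
      using assms(1) by simp
    then show ?thesis
      using power_cost_le[OF assms(1), of \<alpha> u] power_cost_ge_div[OF assms(1), of "u * q" \<alpha>]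
      by linarith
  qed
  define S where "S = (\<Sum>b<B. M (Suc b) * q ^ (B - 1 - b))"
  have eq: "M 0 * q ^ B + S = t * q * q ^ B"
    using Suc.prems unfolding S_def sum.lessThan_Suc_shift by (simp add: mult_ac)
  then have "M 0 * q ^ B \<le> t * q * q ^ B"
    by linarith
  then have le: "M 0 \<le> t * q"
    using assms(3) by simp
  have "S = (t * q - M 0) * q ^ B"
    using eq by (simp add: diff_mult_distrib)
  then have "power_cost p \<alpha> ((t * q - M 0) * q) \<le> (\<Sum>b<B. power_cost p \<alpha> (M (Suc b)))"
    unfolding S_def by (rule Suc.IH)
  moreover have "power_cost p \<alpha> (t * q) \<le> power_cost p \<alpha> (M 0) + power_cost p \<alpha> (t * q - M 0)"
    using power_cost_add[OF assms(1), of \<alpha> "M 0" "t * q - M 0"] le by simp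
  ultimately show ?case
    using mono[of "t * q - M 0"] unfolding sum.lessThan_Suc_shift by simp
qed simp

text \<open>
  \<open>s\<close> is the total, scaled by \<open>p\<^sup>\<alpha>\<close>, of the unit fractions whose denominator is divisible by \<open>q\<close>.
  The other fractions contribute a natural number \<open>M\<^sub>0 \<le> p\<^sup>\<alpha>\<close>, so \<open>s = p\<^sup>\<alpha> - M\<^sub>0\<close> is a natural number too.
\<close>
lemma card_ge_power_cost_two_parts:
  fixes a b :: "'i \<Rightarrow> nat"
  assumes p: "p \<ge> 2" and q: "q \<ge> p ^ \<alpha>" "q > 0" and fin: "finite I"
    and a: "\<And>i. i \<in> I \<Longrightarrow> a i \<le> \<alpha>" and b: "\<And>i. i \<in> I \<Longrightarrow> b i \<le> B"
    and eq: "(\<Sum>i\<in>I. p ^ (\<alpha> - a i) * q ^ (B - b i)) = p ^ \<alpha> * q ^ B"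
    and ex: "\<exists>i\<in>I. b i > 0"
  obtains s where "1 \<le> s" "s \<le> p ^ \<alpha>"
    "card I \<ge> power_cost p \<alpha> (p ^ \<alpha> - s) + power_cost p \<alpha> (s * q)"
proof -
  define J where "J c = {i \<in> I. b i = c}" for c
  define M where "M c = (\<Sum>i\<in>J c. p ^ (\<alpha> - a i))" for c
  have img: "b ` I \<subseteq> {..<Suc B}" using b by (auto simp: less_Suc_eq_le)
  have cost: "power_cost p \<alpha> (M c) \<le> card (J c)" for c
    unfolding M_def using p by (intro power_cost_sum_powers_le_card) auto
  have "card I = (\<Sum>c<Suc B. card (J c))"
    using sum.group[OF fin _ img, of "\<lambda>_. 1::nat"] by (simp add: J_def)
  then have card: "card I \<ge> power_cost p \<alpha> (M 0) + (\<Sum>c<B. power_cost p \<alpha> (M (Suc c)))"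
    unfolding sum.lessThan_Suc_shift using cost by (metis add_mono sum_mono)
  have "(\<Sum>i\<in>I. p ^ (\<alpha> - a i) * q ^ (B - b i)) = (\<Sum>c<Suc B. M c * q ^ (B - c))"
    using sum.group[OF fin _ img, of "\<lambda>i. p ^ (\<alpha> - a i) * q ^ (B - b i)"]
    by (simp add: J_def M_def sum_distrib_right)
  then have layers: "M 0 * q ^ B + (\<Sum>c<B. M (Suc c) * q ^ (B - 1 - c)) = p ^ \<alpha> * q ^ B"
    using eq unfolding sum.lessThan_Suc_shift by simp
  define s where "s = p ^ \<alpha> - M 0"
  have "M 0 * q ^ B \<le> p ^ \<alpha> * q ^ B" using layers by linarith
  then have M0: "M 0 \<le> p ^ \<alpha>" using q(2) by simp
  have tail: "(\<Sum>c<B. M (Suc c) * q ^ (B - 1 - c)) = s * q ^ B"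
    using layers by (simp add: s_def diff_mult_distrib)
  obtain i where i: "i \<in> I" "b i > 0" using ex by blast
  then obtain c where c: "b i = Suc c" using gr0_implies_Suc by blast
  have "c < B" using b[OF i(1)] c by simp
  moreover have "M (Suc c) > 0"
    unfolding M_def using i c fin p by (intro sum_pos2[of _ i]) (auto simp: J_def)
  ultimately have "(\<Sum>c<B. M (Suc c) * q ^ (B - 1 - c)) > 0"
    using q(2) by (intro sum_pos2[of _ c]) auto
  then have "s \<noteq> 0" using tail by (metis less_irrefl mult_0)
  moreover have "power_cost p \<alpha> (s * q) \<le> (\<Sum>c<B. power_cost p \<alpha> (M (Suc c)))"
    using p q tail by (rule power_cost_layers)
  ultimately show thesis
    using card M0 by (intro that[of s]) (auto simp: s_def)
qed

section \<open>The lower bound\<close>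

theorem proposition9:
  fixes p q \<alpha> k n :: nat and x :: "nat \<Rightarrow> nat"
  assumes "prime p" and "\<alpha> \<ge> 1" and "prime q" and "q \<noteq> p"
    and "1 \<le> k" and "k \<le> \<alpha>"
    and "q \<ge> p ^ \<alpha> * ((p - 1) * (2 * \<alpha> - k) + 2) - 2"
    and "n \<ge> 1"
    and "\<forall>i\<in>{1..n}. x i > 0"
    and "(\<Sum>i=1..n. 1 / of_nat (x i)) = (1 :: rat)"
    and "\<forall>i\<in>{1..n}. \<exists>a b. a \<le> \<alpha> \<and> x i = p ^ a * q ^ b"
    and "\<exists>i\<in>{1..n}. p dvd x i"
    and "\<exists>i\<in>{1..n}. q dvd x i"
  shows "n \<ge> (MIN s\<in>{1..p ^ k - 1}.
             (s * q - pow_residue p \<alpha> (s * q)) div p ^ \<alpha> + digit_sum p (pow_residue p \<alpha> (s * q)))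
           + (\<alpha> - k) * (p - 1) + 1"
proof -
  have p: "p \<ge> 2" and q0: "q > 0"
    using assms(1,3) by (auto simp: prime_ge_2_nat prime_gt_0_nat)
  define X where "X = (p - 1) * (2 * \<alpha> - k)"
  have P2: "p ^ \<alpha> \<ge> 2"
    using p assms(2) self_le_power[of p \<alpha>] by linarith
  \<comment> \<open>The hypothesis on \<open>q\<close> enters only through this bound; it loses \<open>P - 2 \<ge> 0\<close>, where \<open>P = p\<^sup>\<alpha>\<close>.\<close>
  have "p ^ \<alpha> * (X + 1) \<le> p ^ \<alpha> * (X + 2) - 2"
    using P2 by (simp add: algebra_simps)
  also have "\<dots> \<le> q"
    using assms(7) unfolding X_def .
  finally have qdiv: "X + 1 \<le> q div p ^ \<alpha>"
    using p by (simp add: less_eq_div_iff_mult_less_eq mult.commute)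
  then have qP: "q \<ge> p ^ \<alpha>"
    by (cases "q < p ^ \<alpha>") auto

  obtain a b where ab: "\<And>i. i \<in> {1..n} \<Longrightarrow> a i \<le> \<alpha> \<and> x i = p ^ a i * q ^ b i"
    using assms(11) by metis
  define B where "B = (\<Sum>i=1..n. b i)"
  have bB: "b i \<le> B" if "i \<in> {1..n}" for i
    unfolding B_def using that by (intro member_le_sum) auto
  have "of_nat (\<Sum>i=1..n. p ^ (\<alpha> - a i) * q ^ (B - b i)) =
      (\<Sum>i=1..n. of_nat (p ^ \<alpha> * q ^ B) * (1 / of_nat (x i)) :: rat)"
    unfolding of_nat_sum
  proof (rule sum.cong)
    fix i assume i: "i \<in> {1..n}"
    have "p ^ \<alpha> = p ^ (\<alpha> - a i) * p ^ a i" "q ^ B = q ^ (B - b i) * q ^ b i"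
      using ab[OF i] bB[OF i] by (simp_all flip: power_add)
    then have "p ^ \<alpha> * q ^ B = (p ^ (\<alpha> - a i) * q ^ (B - b i)) * x i"
      using ab[OF i] by simp
    then show "of_nat (p ^ (\<alpha> - a i) * q ^ (B - b i)) =
        (of_nat (p ^ \<alpha> * q ^ B) * (1 / of_nat (x i)) :: rat)"
      using assms(9) i by (simp del: of_nat_power)
  qed simp
  also have "\<dots> = of_nat (p ^ \<alpha> * q ^ B)"
    unfolding sum_distrib_left[symmetric] assms(10) by simp
  finally have eq: "(\<Sum>i=1..n. p ^ (\<alpha> - a i) * q ^ (B - b i)) = p ^ \<alpha> * q ^ B"
    by (simp only: of_nat_eq_iff)
  have ex: "\<exists>i\<in>{1..n}. b i > 0"
  proof -
    obtain i where i: "i \<in> {1..n}" "q dvd x i" using assms(13) by blast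
    have "b i \<noteq> 0"
    proof
      assume "b i = 0"
      then have "q dvd p ^ a i" using i ab by simp
      then show False
        using assms(1,3,4) prime_dvd_power primes_dvd_imp_eq by blast
    qed
    then show ?thesis using i by blast
  qed
  obtain s where s: "1 \<le> s" "s \<le> p ^ \<alpha>"
    and n: "n \<ge> power_cost p \<alpha> (p ^ \<alpha> - s) + power_cost p \<alpha> (s * q)"
    using card_ge_power_cost_two_parts[OF p qP q0 _ _ _ eq ex] ab bB by auto

  have summand: "(m - pow_residue p \<alpha> m) div p ^ \<alpha> + digit_sum p (pow_residue p \<alpha> m)
      = power_cost p \<alpha> m" for m
    using p by (simp add: pow_residue_def power_cost_eq_digit_sum minus_mod_eq_mult_div)
  have Min_le_cost: "(MIN s\<in>{1..p ^ k - 1}. power_cost p \<alpha> (s * q)) \<le> power_cost p \<alpha> (r * q)"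
    if "1 \<le> r" "r < p ^ k" for r
    using that by (intro Min_le) auto
  have pk: "2 \<le> p ^ k"
    using p assms(5) self_le_power[of p k] by linarith
  have "(MIN s\<in>{1..p ^ k - 1}. power_cost p \<alpha> (s * q)) + (\<alpha> - k) * (p - 1) + 1 \<le> n"
  proof (cases "s < p ^ k")
    case True
    then show ?thesis
      using Min_le_cost[OF s(1) True] power_cost_power_minus_small[OF p assms(6) s(1) True] n
      by linarith
  next
    case False
    have "(2 * (q div p ^ \<alpha>)) * p ^ \<alpha> \<le> 2 * q"
      by (simp add: mult.assoc)
    also have "\<dots> \<le> s * q"
      using False pk by (intro mult_right_mono) auto
    finally have "2 * (q div p ^ \<alpha>) \<le> s * q div p ^ \<alpha>"
      using p by (simp add: less_eq_div_iff_mult_less_eq)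
    also have "\<dots> \<le> power_cost p \<alpha> (s * q)"
      by (rule power_cost_ge_div[OF p])
    also have "\<dots> \<le> n"
      using n by simp
    finally have "2 * (q div p ^ \<alpha>) \<le> n" .
    moreover have "(MIN s\<in>{1..p ^ k - 1}. power_cost p \<alpha> (s * q)) \<le> q div p ^ \<alpha> + \<alpha> * (p - 1)"
      using Min_le_cost[of 1] power_cost_upper[OF p, of \<alpha> q] pk by simp
    moreover have "\<alpha> * (p - 1) + (\<alpha> - k) * (p - 1) = X"
    proof -
      have "2 * \<alpha> - k = \<alpha> + (\<alpha> - k)" using assms(6) by simp
      then show ?thesis by (simp only: X_def add_mult_distrib2 mult.commute)
    qed
    ultimately show ?thesis
      using qdiv by linarith
  qed
  then show ?thesis
    unfolding summand .
qed

end
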